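(* Let $H$ be a fixed (finite, simple) graph with chromatic number $\chi(H)\le 5$. Then there is an integer $N_H$ such that every finite point set $P\subset\mathbb{R}^2$ with $|P|\ge N_H$ contains four collinear points or has a copy of $H$ in its visibility graph $\mathcal{V}_P$.
   Context: For a finite point set $P\subset\mathbb{R}^2$, two distinct points $p,q\in P$ are visible in $P$ if the open line segment joining them contains no point of $P$. The visibility graph $\mathcal{V}_P$ has vertex set $P$, with two distinct vertices adjacent if and only if they are visible in $P$. A copy of a graph $H$ in a graph $G$ means a (not necessarily induced) subgraph of $G$ isomorphic to $H$. *)

theory Defs
  imports
    "HOL-Analysis.Analysis"
    "Graph_Theory.Pair_Digraph"
    "Graph_Theory.Digraph_Component"
    "Graph_Theory.Digraph_Isomorphism"
begin

text \<open>
  A finite simple graph is a \<^locale>\<open>pair_graph\<close>: finite, loop-free and symmetric, so that an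
  undirected edge is represented by its two orientations.
\<close>

definition visibility_graph :: "(real^2) set \<Rightarrow> (real^2) pair_pre_digraph" where
  "visibility_graph P =
     \<lparr> pverts = P,
       parcs = {(p, q). p \<in> P \<and> q \<in> P \<and> p \<noteq> q \<and> open_segment p q \<inter> P = {}} \<rparr>"

lemma pair_graph_visibility_graph:
  assumes "finite P"
  shows "pair_graph (visibility_graph P)"
proof -
  have "parcs (visibility_graph P) \<subseteq> P \<times> P"
    by (auto simp: visibility_graph_def)
  then have "finite (parcs (visibility_graph P))"
    using assms by (meson finite_SigmaI finite_subset)
  then show ?thesis
    using assms
    by unfold_locales
      (auto simp: visibility_graph_def symmetric_def sym_def open_segment_commute)
qed

definition proper_coloring :: "'a pair_pre_digraph \<Rightarrow> nat \<Rightarrow> ('a \<Rightarrow> nat) \<Rightarrow> bool" where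
  "proper_coloring H k c \<longleftrightarrow>
     (\<forall>v\<in>pverts H. c v < k) \<and> (\<forall>(u, v)\<in>parcs H. c u \<noteq> c v)"

text \<open>
  The minimum exists for finite loop-free graphs (see below); for other arguments the value is
  unspecified.
\<close>

definition chromatic_number :: "'a pair_pre_digraph \<Rightarrow> nat" where
  "chromatic_number H = (LEAST k. \<exists>c. proper_coloring H k c)"

lemma chromatic_number_attained:
  assumes "pair_graph H"
  shows "\<exists>c. proper_coloring H (chromatic_number H) c"
proof -
  interpret pair_graph H by fact
  obtain c where c: "bij_betw c (pverts H) {0..<card (pverts H)}"
    using ex_bij_betw_finite_nat[OF pair_finite_verts] by blast
  have "proper_coloring H (card (pverts H)) c"
    unfolding proper_coloring_def
  proof (intro conjI ballI)
    fix v assume "v \<in> pverts H"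
    then show "c v < card (pverts H)"
      using bij_betwE[OF c] by auto
  next
    fix e assume e: "e \<in> parcs H"
    then have "c (fst e) \<noteq> c (snd e)"
      using bij_betw_imp_inj_on[OF c] pair_no_loops[OF e] arc_fst_in_verts[OF e] arc_snd_in_verts[OF e]
      by (auto dest: inj_onD)
    then show "case e of (u, v) \<Rightarrow> c u \<noteq> c v"
      by (simp add: case_prod_beta)
  qed
  then have "\<exists>k c. proper_coloring H k c" by blast
  then show ?thesis
    unfolding chromatic_number_def by (rule LeastI_ex)
qed

definition has_copy :: "'a pair_pre_digraph \<Rightarrow> 'b pair_pre_digraph \<Rightarrow> bool" where
  "has_copy H G \<longleftrightarrow>
     (\<exists>K. subgraph (with_proj K) (with_proj G) \<and> digraph_iso (with_proj H) (with_proj K))"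

definition four_collinear :: "(real^2) set \<Rightarrow> bool" where
  "four_collinear P \<longleftrightarrow> (\<exists>Q\<subseteq>P. card Q = 4 \<and> collinear Q)"

end

theory Submission
  imports Defs
begin

text \<open>
  If no four points are collinear, the invisible pairs of \<open>P\<close> correspond to the collinear triples of
  \<open>P\<close>, and two such triples share at most one point.  Cut \<open>P\<close> by parallel lines into consecutive
  slabs \<open>A\<close>, \<open>B\<close>, \<open>C\<close> of \<open>m\<close> points each.  A triple within \<open>A \<union> B\<close> or \<open>B \<union> C\<close> has at least two
  points in one slab, and each of the \<open>3 (m choose 2)\<close> pairs within a slab lies in at most one
  triple, so not all of \<open>A\<close>, \<open>B\<close>, \<open>C\<close>, \<open>A \<union> B\<close>, \<open>B \<union> C\<close> can contain many triples: one of them, \<open>Q\<close>,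
  contains at most \<open>3/26 (card Q)\<^sup>2\<close>.  Since \<open>Q\<close> is cut out of \<open>P\<close> by a convex set, the visibility
  graph of \<open>P\<close> has edge density about \<open>10/13\<close> on \<open>Q\<close>.  This exceeds \<open>3/4\<close>, so by the Erdos-Stone
  theorem it contains a complete 5-partite graph with large parts, hence a copy of every graph \<open>H\<close>
  with chromatic number at most 5.
\<close>

section \<open>Complete multipartite subgraphs of dense graphs\<close>

text \<open>For irreflexive \<open>E\<close> the sets \<open>F i\<close> with \<open>i < r\<close>
  are pairwise disjoint, so they are the parts of a complete \<open>r\<close>-partite
  subgraph.\<close>

definition mutually_joined :: "('v \<Rightarrow> 'v \<Rightarrow> bool) \<Rightarrow> nat \<Rightarrow> (nat \<Rightarrow> 'v set) \<Rightarrow> bool" where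
  "mutually_joined E r F \<longleftrightarrow> (\<forall>i<r. \<forall>j<r. i \<noteq> j \<longrightarrow> (\<forall>x\<in>F i. \<forall>y\<in>F j. E x y))"

lemma sum_card_neighbours_swap:
  assumes "finite A" "finite B" "symp E"
  shows "(\<Sum>a\<in>A. card {b\<in>B. E a b}) = (\<Sum>b\<in>B. card {a\<in>A. E b a})"
proof -
  have "(\<Sum>a\<in>A. card {b\<in>B. E a b}) = (\<Sum>b\<in>B. card {a\<in>A. E a b})"
    using assms by (intro sum_multicount_gen) auto
  also have "\<dots> = (\<Sum>b\<in>B. card {a\<in>A. E b a})"
    using sympD[OF \<open>symp E\<close>] by (intro sum.cong arg_cong[where f = card]) auto
  finally show ?thesis .
qed

text \<open>
  A vertex with fewer than \<open>t\<close> neighbours in some part \<open>F i\<close> has at most \<open>(r - 1) T + t\<close> neighbours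
  in all the parts together; double counting the edges at the parts shows that few vertices are of
  this kind.
\<close>

lemma many_vertices_joined_to_all_parts:
  fixes d :: real and r t T :: nat
  assumes V: "finite V" and E: "symp E"
    and deg: "\<And>v. v \<in> V \<Longrightarrow> d * card V \<le> card {u\<in>V. E v u}"
    and F: "\<And>i. i < r \<Longrightarrow> F i \<subseteq> V \<and> card (F i) = T"
    and T: "0 < T" "2 * t \<le> T * (1 - r * (1 - d))"
  shows "(1 - r * (1 - d)) * card V \<le> 2 * card {u\<in>V. \<forall>i<r. t \<le> card {x\<in>F i. E u x}}"
proof -
  define W where "W = {u\<in>V. \<forall>i<r. t \<le> card {x\<in>F i. E u x}}"
  define a where "a u = (\<Sum>i<r. card {x\<in>F i. E u x})" for u
  have finF: "finite (F i)" if "i < r" for i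
    using F[OF that] V finite_subset by blast
  have part: "card {x\<in>F i. E u x} \<le> T" if "i < r" for i u
    using card_mono[OF finF[OF that], of "{x\<in>F i. E u x}"] F[OF that] by auto
  have aW: "a u \<le> r * T" for u
    unfolding a_def using sum_bounded_above[of "{..<r}" "\<lambda>i. card {x\<in>F i. E u x}" T] part by simp
  have anW: "a u + T \<le> r * T + t" if u: "u \<in> V - W" for u
  proof -
    obtain i where i: "i < r" "card {x\<in>F i. E u x} < t"
      using u unfolding W_def by (auto simp: not_le)
    have "(\<Sum>j\<in>{..<r}-{i}. card {x\<in>F j. E u x}) \<le> card ({..<r}-{i}) * T"
      using sum_bounded_above[of "{..<r}-{i}" "\<lambda>i. card {x\<in>F i. E u x}" T] part by simp
    moreover have "a u = card {x\<in>F i. E u x} + (\<Sum>j\<in>{..<r}-{i}. card {x\<in>F j. E u x})"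
      unfolding a_def using i by (simp add: sum.remove)
    moreover have "r * T = card ({..<r}-{i}) * T + T"
      using i by (cases r) (auto simp: algebra_simps)
    ultimately show ?thesis using i by linarith
  qed
  have "(\<Sum>u\<in>V. a u) = (\<Sum>i<r. \<Sum>x\<in>F i. card {u\<in>V. E x u})"
    unfolding a_def by (subst sum.swap) (intro sum.cong refl sum_card_neighbours_swap V finF E, auto)
  moreover have "real T * (d * card V) \<le> real (\<Sum>x\<in>F i. card {u\<in>V. E x u})" if "i < r" for i
  proof -
    have "(\<Sum>x\<in>F i. d * card V) \<le> (\<Sum>x\<in>F i. real (card {u\<in>V. E x u}))"
      using F[OF that] deg by (intro sum_mono) auto
    then show ?thesis using F[OF that] by simp
  qed
  then have "(\<Sum>i<r. real T * (d * card V)) \<le> (\<Sum>i<r. real (\<Sum>x\<in>F i. card {u\<in>V. E x u}))"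
    by (intro sum_mono) auto
  ultimately have lower: "r * (T * (d * card V)) \<le> real (\<Sum>u\<in>V. a u)"
    by simp
  have WV: "W \<subseteq> V" unfolding W_def by auto
  have "(\<Sum>u\<in>V. a u) + card (V - W) * T = (\<Sum>u\<in>W. a u) + (\<Sum>u\<in>V-W. a u + T)"
    using sum.subset_diff[OF WV V, of a] by (simp add: sum.distrib)
  also have "\<dots> \<le> (\<Sum>u\<in>W. r * T) + (\<Sum>u\<in>V-W. r * T + t)"
    by (intro add_mono sum_mono aW anW) auto
  also have "\<dots> = card W * (r * T) + card (V - W) * (r * T + t)"
    by simp
  finally have upper: "real (\<Sum>u\<in>V. a u) + card (V - W) * T
      \<le> card W * (r * T) + card (V - W) * (r * T + t)"
    by (metis (mono_tags, lifting) of_nat_add of_nat_le_iff of_nat_mult)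
  have VW: "real (card (V - W)) = real (card V) - real (card W)"
    using card_Diff_subset[OF finite_subset[OF WV V] WV] card_mono[OF V WV] by (simp add: of_nat_diff)
  define \<delta> where "\<delta> = 1 - real r * (1 - d)"
  have "T * \<delta> * card V \<le> real (card W * T) + real (t * card V) - real (t * card W)"
    using lower upper by (simp add: \<delta>_def VW algebra_simps)
  \<comment> \<open>This makes \<open>t * card V\<close> at most half of the left side above, so it
    can be absorbed there.\<close>
  moreover have "real (2 * t) * card V \<le> T * \<delta> * card V"
    unfolding \<delta>_def by (intro mult_right_mono T(2)) auto
  moreover have "0 \<le> real (t * card W)" by simp
  ultimately have "T * \<delta> * card V \<le> 2 * real (card W * T)"
    unfolding of_nat_mult of_nat_numeral by linarith
  then have "real T * (\<delta> * card V) \<le> T * (2 * card W)"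
    by (simp add: algebra_simps)
  then show ?thesis
    using T(1) unfolding W_def \<delta>_def by simp
qed

text \<open>
  By the pigeonhole principle, \<open>t\<close> of these vertices are joined to the same \<open>t\<close>-subset of every
  part.
\<close>

lemma extend_mutually_joined:
  fixes d :: real and r t T :: nat
  assumes V: "finite V" and E: "symp E"
    and deg: "\<And>v. v \<in> V \<Longrightarrow> d * card V \<le> card {u\<in>V. E v u}"
    and F: "\<And>i. i < r \<Longrightarrow> F i \<subseteq> V \<and> card (F i) = T" and joined: "mutually_joined E r F"
    and T: "0 < T" "t \<le> T" "2 * t \<le> T * (1 - r * (1 - d))"
    and n: "2 * (t * (T choose t) ^ r) \<le> (1 - r * (1 - d)) * card V"
  shows "\<exists>F'. (\<forall>i<Suc r. F' i \<subseteq> V \<and> card (F' i) = t) \<and> mutually_joined E (Suc r) F'"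
proof -
  define W where "W = {u\<in>V. \<forall>i<r. t \<le> card {x\<in>F i. E u x}}"
  \<comment> \<open>The pigeonholes: an element of \<open>B\<close> selects a
    \<open>t\<close>-subset of every old part.\<close>
  define B where "B = (\<Pi>\<^sub>E i\<in>{..<r}. {S. S \<subseteq> F i \<and> card S = t})"
  have finF: "finite (F i)" if "i < r" for i
    using F[OF that] V finite_subset by blast
  have finW: "finite W" and WV: "W \<subseteq> V" unfolding W_def using V by auto
  have cardB: "card B = (T choose t) ^ r"
    unfolding B_def using F finF by (simp add: card_PiE n_subsets)
  have "\<exists>S. S \<subseteq> {x\<in>F i. E u x} \<and> card S = t" if "u \<in> W" "i < r" for u i
    using that unfolding W_def by (metis (mono_tags, lifting) mem_Collect_eq obtain_subset_with_card_n)
  then obtain s where s: "\<And>u i. u \<in> W \<Longrightarrow> i < r \<Longrightarrow> s u i \<subseteq> {x\<in>F i. E u x} \<and> card (s u i) = t"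
    by metis
  have sB: "(\<lambda>u. restrict (s u) {..<r}) \<in> W \<rightarrow> B"
    unfolding B_def using s by (fastforce simp: PiE_iff)
  have posB: "0 < card B" using cardB T by simp
  then obtain S where S: "S \<in> B"
      "card W \<le> card ((\<lambda>u. restrict (s u) {..<r}) -` {S} \<inter> W) * card B"
    using pigeonhole_card[OF sB finW] by (metis card.empty card.infinite less_irrefl)
  have "(1 - r * (1 - d)) * card V \<le> 2 * card W"
    unfolding W_def using many_vertices_joined_to_all_parts[OF V E deg F T(1,3)] by simp
  then have "t * card B \<le> card W"
    using n cardB by (metis (no_types, opaque_lifting) mult_le_cancel_left_pos of_nat_le_iff of_nat_mult
        of_nat_numeral order_trans zero_less_numeral)
  then have "t \<le> card ((\<lambda>u. restrict (s u) {..<r}) -` {S} \<inter> W)"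
    using S(2) posB by (meson mult_le_cancel2 order_trans)
  then obtain R where R: "R \<subseteq> (\<lambda>u. restrict (s u) {..<r}) -` {S} \<inter> W" "card R = t"
    by (meson obtain_subset_with_card_n)
  have RS: "E u x" "E x u" if "u \<in> R" "i < r" "x \<in> S i" for u x i
  proof -
    have "S i = s u i" "u \<in> W" using R(1) that by auto
    then show "E u x" using s[of u i] that by auto
    then show "E x u" using E by (meson sympD)
  qed
  have Si: "S i \<subseteq> F i" "card (S i) = t" if "i < r" for i
    using S(1) that unfolding B_def by auto
  have "mutually_joined E (Suc r) (S(r := R))"
    unfolding mutually_joined_def
  proof (intro allI impI ballI)
    fix i j x y assume "i < Suc r" "j < Suc r" "i \<noteq> j" "x \<in> (S(r := R)) i" "y \<in> (S(r := R)) j"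
    then consider "i = r" "j < r" "x \<in> R" "y \<in> S j" | "j = r" "i < r" "y \<in> R" "x \<in> S i"
      | "i < r" "j < r" "i \<noteq> j" "x \<in> S i" "y \<in> S j"
      by (auto simp: less_Suc_eq split: if_splits)
    then show "E x y"
    proof cases
      case 3
      then show ?thesis
        using joined Si(1) unfolding mutually_joined_def by blast
    qed (use RS in auto)
  qed
  moreover have "\<forall>i<Suc r. (S(r := R)) i \<subseteq> V \<and> card ((S(r := R)) i) = t"
    using Si F R WV by (auto simp: less_Suc_eq) blast+
  ultimately show ?thesis by blast
qed

text \<open>Induction on \<open>r\<close>, asking for larger parts at the previous stage. The
  condition amounts to \<open>(r - 1) * (1 - d) < 1\<close>; for \<open>r \<ge> 2\<close> this puts
  \<open>d\<close> above the Turan density \<open>1 - 1 / (r - 1)\<close>.\<close>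

lemma erdos_stone_min_degree:
  fixes d :: real
  assumes "d \<le> 1"
  shows "real r * (1 - d) < 1 + (1 - d) \<Longrightarrow>
    \<exists>n0. \<forall>(V :: 'v set) E. finite V \<and> n0 \<le> card V \<and> symp E \<and>
      (\<forall>v\<in>V. d * card V \<le> card {u\<in>V. E v u}) \<longrightarrow>
      (\<exists>F. (\<forall>i<r. F i \<subseteq> V \<and> card (F i) = t) \<and> mutually_joined E r F)"
proof (induction r arbitrary: t)
  case 0
  then show ?case by (auto simp: mutually_joined_def)
next
  case (Suc r)
  define \<delta> where "\<delta> = 1 - r * (1 - d)"
  have "\<delta> > 0" using Suc.prems unfolding \<delta>_def by (simp add: algebra_simps)
  \<comment> \<open>With \<open>2 * t \<le> T * \<delta>\<close>, at least
    \<open>\<delta> / 2 * card V\<close> vertices have \<open>t\<close> neighbours in every part of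
    size \<open>T\<close>.\<close>
  define T where "T = Suc t + nat \<lceil>2 * t / \<delta>\<rceil>"
  have "2 * t / \<delta> \<le> T" unfolding T_def by linarith
  then have T: "0 < T" "t \<le> T" "2 * t \<le> T * \<delta>"
    using \<open>\<delta> > 0\<close> by (auto simp: field_simps T_def)
  have "real r * (1 - d) < 1 + (1 - d)"
    using Suc.prems \<open>d \<le> 1\<close> by (simp add: algebra_simps)
  from Suc.IH[OF this, of T] obtain n1 where
    n1: "\<forall>(V :: 'v set) E. finite V \<and> n1 \<le> card V \<and> symp E \<and>
      (\<forall>v\<in>V. d * card V \<le> card {u\<in>V. E v u}) \<longrightarrow>
      (\<exists>F. (\<forall>i<r. F i \<subseteq> V \<and> card (F i) = T) \<and> mutually_joined E r F)"
    by (rule exE)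
  \<comment> \<open>From here on those vertices number at least \<open>t\<close> per
    pigeonhole.\<close>
  define n2 where "n2 = nat \<lceil>2 * (t * (T choose t) ^ r) / \<delta>\<rceil>"
  show ?case
  proof (intro exI[of _ "max n1 n2"] allI impI, elim conjE)
    fix V :: "'v set" and E
    assume V: "finite V" "max n1 n2 \<le> card V" "symp E" "\<forall>v\<in>V. d * card V \<le> card {u\<in>V. E v u}"
    then obtain F where F: "\<forall>i<r. F i \<subseteq> V \<and> card (F i) = T" "mutually_joined E r F"
      using n1[rule_format, of V E] by auto
    have "2 * (t * (T choose t) ^ r) / \<delta> \<le> card V"
      using V(2) unfolding n2_def by linarith
    then have n: "2 * (t * (T choose t) ^ r) \<le> \<delta> * card V"
      using \<open>\<delta> > 0\<close> by (simp add: field_simps)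
    show "\<exists>F. (\<forall>i<Suc r. F i \<subseteq> V \<and> card (F i) = t) \<and> mutually_joined E (Suc r) F"
      using extend_mutually_joined[OF V(1,3) _ _ F(2) T[unfolded \<delta>_def] n[unfolded \<delta>_def]] V(4) F(1)
      by simp
  qed
qed

text \<open>
  A set \<open>S\<close> maximising the number of ordered adjacent pairs minus \<open>c (card S)\<^sup>2\<close> has large minimum
  degree, since deleting a vertex cannot increase this quantity.
\<close>

lemma dense_graph_has_subset_of_large_min_degree:
  fixes c :: real
  assumes V: "finite V" and E: "symp E" "irreflp E" and "0 \<le> c"
  obtains S where "S \<subseteq> V"
    "card {(x, y) \<in> V \<times> V. E x y} - c * (card V)\<^sup>2 \<le> (card S)\<^sup>2"
    "\<And>v. v \<in> S \<Longrightarrow> c * (card S - 1 / 2) \<le> card {u\<in>S. E v u}"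
proof -
  define g where "g S = card {(x, y) \<in> S \<times> S. E x y} - c * (card S)\<^sup>2" for S
  obtain S where S: "S \<subseteq> V" and max: "\<And>S'. S' \<subseteq> V \<Longrightarrow> g S' \<le> g S"
  proof -
    have "Max (g ` Pow V) \<in> g ` Pow V" using V by (intro Max_in) auto
    then obtain S where "S \<in> Pow V" "g S = Max (g ` Pow V)" by auto
    with V show ?thesis by (intro that[of S]) auto
  qed
  have finS: "finite S" using S V finite_subset by blast
  show ?thesis
  proof
    \<comment> \<open>The trivial edge bound on \<open>g S\<close>, compared with
      \<open>g V\<close>, keeps \<open>S\<close> from being small.\<close>
    have "card {(x, y) \<in> S \<times> S. E x y} \<le> card (S \<times> S)"
      using finS by (intro card_mono) auto
    then have "real (card {(x, y) \<in> S \<times> S. E x y}) \<le> (card S)\<^sup>2"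
      by (simp add: card_cartesian_product power2_eq_square flip: of_nat_mult)
    moreover have "0 \<le> c * (card S)\<^sup>2" using \<open>0 \<le> c\<close> by simp
    ultimately have "g S \<le> (card S)\<^sup>2"
      unfolding g_def by linarith
    with max[of V] show "card {(x, y) \<in> V \<times> V. E x y} - c * (card V)\<^sup>2 \<le> (card S)\<^sup>2"
      unfolding g_def by simp
  next
    fix v assume v: "v \<in> S"
    define N where "N = {u\<in>S. E v u}"
    have "{(x, y) \<in> S \<times> S. E x y} =
        {(x, y) \<in> (S - {v}) \<times> (S - {v}). E x y} \<union> Pair v ` N \<union> (\<lambda>u. (u, v)) ` N"
      using v E by (auto simp: N_def irreflp_def dest: sympD)
    also have "card \<dots> \<le> card {(x, y) \<in> (S - {v}) \<times> (S - {v}). E x y} + card N + card N"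
      by (intro order_trans[OF card_Un_le] add_mono order_refl card_image_le) (auto simp: N_def finS)
    \<comment> \<open>Deleting \<open>v\<close> lowers the squared size by
      \<open>2 * card S - 1\<close>, which is the source of the \<open>1 / 2\<close> in the degree
      bound.\<close>
    finally have "g S \<le> g (S - {v}) + 2 * card N - c * ((real (card S))\<^sup>2 - (real (card (S - {v})))\<^sup>2)"
      unfolding g_def by (simp add: algebra_simps)
    moreover have "g (S - {v}) \<le> g S" using S by (intro max) auto
    moreover have "card S = Suc (card (S - {v}))"
      using card_Suc_Diff1[OF finS v] by simp
    ultimately show "c * (card S - 1 / 2) \<le> card {u\<in>S. E v u}"
      unfolding N_def by (simp add: power2_eq_square algebra_simps)
  qed (use S in auto)
qed

section \<open>Linear triple systems\<close>

text \<open>The left side counts 2-subsets of \<open>S\<close> lying in a member of the family, and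
  by linearity no 2-subset is counted twice.\<close>

lemma sum_choose_two_linear_family_le:
  assumes fin: "finite \<T>" "finite S"
    and linear: "\<And>X Y. X \<in> \<T> \<Longrightarrow> Y \<in> \<T> \<Longrightarrow> X \<noteq> Y \<Longrightarrow> card (X \<inter> Y \<inter> S) \<le> 1"
  shows "(\<Sum>X\<in>\<T>. card (X \<inter> S) choose 2) \<le> card S choose 2"
proof -
  define pairs where "pairs X = {p. p \<subseteq> X \<inter> S \<and> card p = 2}" for X
  have finp: "finite (pairs X)" for X
    unfolding pairs_def using fin(2) by (auto intro: finite_subset[of _ "Pow S"])
  have "pairs X \<inter> pairs Y = {}" if XY: "X \<in> \<T>" "Y \<in> \<T>" "X \<noteq> Y" for X Y
  proof -
    have False if "p \<in> pairs X" "p \<in> pairs Y" for p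
    proof -
      have "p \<subseteq> X \<inter> Y \<inter> S" "card p = 2" using that unfolding pairs_def by auto
      then have "2 \<le> card (X \<inter> Y \<inter> S)" by (metis card_mono fin(2) finite_Int)
      with linear[OF XY] show False by simp
    qed
    then show ?thesis by blast
  qed
  then have "(\<Sum>X\<in>\<T>. card (pairs X)) = card (\<Union>X\<in>\<T>. pairs X)"
    using fin finp by (subst card_UN_disjoint) auto
  also have "\<dots> \<le> card {p. p \<subseteq> S \<and> card p = 2}"
    using fin by (intro card_mono) (auto simp: pairs_def)
  finally show ?thesis
    unfolding pairs_def using fin by (simp add: n_subsets del: Int_subset_iff inf.bounded_iff)
qed

text \<open>The weights make both sides 3 for a triple inside one class; \<open>B\<close> gets less
  because it lies in both unions. A triple split between two adjacent classes has weight 1 and two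
  points in one of them.\<close>

lemma triple_weight_le:
  assumes X: "card X = 3" and disj: "A \<inter> B = {}" "B \<inter> C = {}" "A \<inter> C = {}"
  shows "of_bool (X \<subseteq> A \<union> B) + of_bool (X \<subseteq> B \<union> C)
      + 2 * of_bool (X \<subseteq> A) + of_bool (X \<subseteq> B) + 2 * of_bool (X \<subseteq> C)
    \<le> (card (X \<inter> A) choose 2) + (card (X \<inter> B) choose 2) + (card (X \<inter> C) choose 2)"
proof -
  obtain x y z where "X = {x, y, z}" "x \<noteq> y" "y \<noteq> z" "x \<noteq> z"
    using X by (auto simp: card_3_iff)
  then show ?thesis
    using disj by (auto simp: choose_two card_insert_if Int_insert_left)
qed

text \<open>
  With \<open>\<tau> Q\<close> the number of triples inside \<open>Q\<close>, summing the previous inequality over all triples gives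
  \<open>\<tau>(A \<union> B) + \<tau>(B \<union> C) + 2 \<tau>(A) + \<tau>(B) + 2 \<tau>(C) \<le> 3m\<^sup>2/2\<close>.  If every one of these sets had
  more than \<open>\<epsilon> (card Q)\<^sup>2\<close> triples, the left side would exceed \<open>13 \<epsilon> m\<^sup>2\<close>, whence \<open>\<epsilon> = 3/26\<close>.
\<close>

lemma sparse_part_of_linear_triple_system:
  assumes fin: "finite \<T>" "finite A" "finite B" "finite C"
    and triples: "\<And>X. X \<in> \<T> \<Longrightarrow> card X = 3"
    and linear: "\<And>X Y. X \<in> \<T> \<Longrightarrow> Y \<in> \<T> \<Longrightarrow> X \<noteq> Y \<Longrightarrow> card (X \<inter> Y) \<le> 1"
    and disj: "A \<inter> B = {}" "B \<inter> C = {}" "A \<inter> C = {}"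
    and m: "card A = m" "card B = m" "card C = m"
  shows "\<exists>Q\<in>{A, B, C, A \<union> B, B \<union> C}. 26 * card {X\<in>\<T>. X \<subseteq> Q} \<le> 3 * (card Q)\<^sup>2"
proof (rule ccontr)
  define \<tau> where "\<tau> Q = card {X\<in>\<T>. X \<subseteq> Q}" for Q
  assume "\<not> ?thesis"
  then have "3 * (card Q)\<^sup>2 < 26 * \<tau> Q" if "Q \<in> {A, B, C, A \<union> B, B \<union> C}" for Q
    using that unfolding \<tau>_def by (meson linorder_not_le)
  from this[of A] this[of B] this[of C] this[of "A \<union> B"] this[of "B \<union> C"]
  have dense: "3 * m\<^sup>2 < 26 * \<tau> A" "3 * m\<^sup>2 < 26 * \<tau> B" "3 * m\<^sup>2 < 26 * \<tau> C"
    "12 * m\<^sup>2 < 26 * \<tau> (A \<union> B)" "12 * m\<^sup>2 < 26 * \<tau> (B \<union> C)"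
    using fin disj m by (simp_all add: card_Un_disjoint power2_eq_square algebra_simps)
  have \<tau>: "\<tau> Q = (\<Sum>X\<in>\<T>. of_bool (X \<subseteq> Q))" for Q
    using fin(1) by (simp add: \<tau>_def Int_def)
  have le: "2 * (\<Sum>X\<in>\<T>. card (X \<inter> S) choose 2) \<le> m\<^sup>2" if "finite S" "card S = m" for S
  proof -
    have "card (X \<inter> Y \<inter> S) \<le> 1" if "X \<in> \<T>" "Y \<in> \<T>" "X \<noteq> Y" for X Y
      using linear[OF that] card_mono[of "X \<inter> Y" "X \<inter> Y \<inter> S"] triples[of X] that
      by (metis card.infinite finite_Int inf_le1 le_trans numeral_neq_zero)
    with sum_choose_two_linear_family_le[OF fin(1) \<open>finite S\<close>]
    have "(\<Sum>X\<in>\<T>. card (X \<inter> S) choose 2) \<le> card S choose 2" by blast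
    then have "2 * (\<Sum>X\<in>\<T>. card (X \<inter> S) choose 2) \<le> m * (m - 1)"
      using \<open>card S = m\<close> by (simp add: choose_two)
    also have "\<dots> \<le> m\<^sup>2" by (simp add: power2_eq_square)
    finally show ?thesis .
  qed
  have "\<tau> (A \<union> B) + \<tau> (B \<union> C) + 2 * \<tau> A + \<tau> B + 2 * \<tau> C
      = (\<Sum>X\<in>\<T>. of_bool (X \<subseteq> A \<union> B) + of_bool (X \<subseteq> B \<union> C)
          + 2 * of_bool (X \<subseteq> A) + of_bool (X \<subseteq> B) + 2 * of_bool (X \<subseteq> C))"
    unfolding \<tau> sum_distrib_left sum.distrib ..
  also have "\<dots> \<le> (\<Sum>X\<in>\<T>. (card (X \<inter> A) choose 2) + (card (X \<inter> B) choose 2) + (card (X \<inter> C) choose 2))"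
    by (intro sum_mono triple_weight_le triples disj)
  finally have "2 * (\<tau> (A \<union> B) + \<tau> (B \<union> C) + 2 * \<tau> A + \<tau> B + 2 * \<tau> C) \<le> 3 * m\<^sup>2"
    using le[of A] le[of B] le[of C] fin m by (simp add: sum.distrib)
  \<comment> \<open>With weights 1, 1, 2, 1, 2 the strict bounds add up to more than
    \<open>39 * m\<^sup>2\<close>, which is 13 times the upper bound just obtained.\<close>
  with dense show False by (simp add: algebra_simps)
qed

section \<open>Visibility graphs\<close>

text \<open>Downward induction: lowering the threshold to the largest value below it drops exactly
  one point, by injectivity.\<close>

lemma exists_threshold:
  fixes f :: "'a \<Rightarrow> real"
  assumes "finite P" "inj_on f P" "k \<le> card P"
  shows "\<exists>r. card {p\<in>P. f p < r} = k"
  using \<open>k \<le> card P\<close>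
proof (induction k rule: inc_induct)
  case base
  have "f p \<le> Max (f ` P)" if "p \<in> P" for p
    using that assms(1) by (intro Max.coboundedI) auto
  then have "f p < Max (f ` P) + 1" if "p \<in> P" for p
    using that by (meson less_add_one order_le_less_trans)
  then have "{p\<in>P. f p < Max (f ` P) + 1} = P" by auto
  then show ?case by metis
next
  case (step k)
  then obtain r where r: "card {p\<in>P. f p < r} = Suc k" by blast
  then have "{p\<in>P. f p < r} \<noteq> {}" by (metis card.empty nat.distinct(1))
  then obtain q where q: "q \<in> P" "f q < r" and max: "\<And>p. p \<in> P \<Longrightarrow> f p < r \<Longrightarrow> f p \<le> f q"
  proof -
    assume ne: "{p\<in>P. f p < r} \<noteq> {}"
    have "Max (f ` {p\<in>P. f p < r}) \<in> f ` {p\<in>P. f p < r}"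
      using ne assms(1) by (intro Max_in) auto
    then obtain q where "q \<in> P" "f q < r" "f q = Max (f ` {p\<in>P. f p < r})" by auto
    then show ?thesis using assms(1) by (intro that[of q]) auto
  qed
  have "p = q" if "p \<in> P" "f p < r" "\<not> f p < f q" for p
    using max[OF that(1,2)] that(3) inj_onD[OF assms(2) _ that(1) q(1)] by linarith
  then have "{p\<in>P. f p < f q} = {p\<in>P. f p < r} - {q}"
    using q by fastforce
  then have "card {p\<in>P. f p < f q} = k"
    using r q by simp
  then show ?case by blast
qed

lemma three_consecutive_slabs:
  fixes f :: "'a \<Rightarrow> real"
  assumes P: "finite P" "inj_on f P" and m: "3 * m \<le> card P"
  obtains r0 r1 r2 r3 where "r0 \<le> r1" "r1 \<le> r2" "r2 \<le> r3"
    "card {p\<in>P. r0 \<le> f p \<and> f p < r1} = m"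
    "card {p\<in>P. r1 \<le> f p \<and> f p < r2} = m"
    "card {p\<in>P. r2 \<le> f p \<and> f p < r3} = m"
proof -
  define below where "below r = {p\<in>P. f p < r}" for r
  have "\<exists>r. card (below r) = k" if "k \<le> 3 * m" for k
    unfolding below_def using that m by (intro exists_threshold P) simp
  then obtain r where r: "\<And>k. k \<le> 3 * m \<Longrightarrow> card (below (r k)) = k" by metis
  have slab: "r k \<le> r (k + m) \<and> card {p\<in>P. r k \<le> f p \<and> f p < r (k + m)} = m"
    if "k + m \<le> 3 * m" "0 < m" for k
  proof -
    have "r k \<le> r (k + m)"
    proof (rule ccontr)
      assume "\<not> ?thesis"
      then have "card (below (r (k + m))) \<le> card (below (r k))"
        using P(1) by (intro card_mono) (auto simp: below_def)
      then show False using r that by simp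
    qed
    then have "{p\<in>P. r k \<le> f p \<and> f p < r (k + m)} = below (r (k + m)) - below (r k)"
      and "below (r k) \<subseteq> below (r (k + m))"
      by (auto simp: below_def)
    then have "card {p\<in>P. r k \<le> f p \<and> f p < r (k + m)} = m"
      using r that P(1) by (simp add: card_Diff_subset below_def)
    with \<open>r k \<le> r (k + m)\<close> show ?thesis by simp
  qed
  show thesis
  proof (cases "m = 0")
    case True
    then show thesis by (intro that[of 0 0 0 0]) (auto simp: not_less[symmetric])
  next
    case False
    show thesis
      using slab[of 0] slab[of m] slab[of "2 * m"] False
      by (intro that[of "r 0" "r m" "r (2 * m)" "r (3 * m)"]) (simp_all flip: mult_2)
  qed
qed

section \<open>Collinear triples and visible pairs\<close>

abbreviation visible :: "(real^2) set \<Rightarrow> real^2 \<Rightarrow> real^2 \<Rightarrow> bool" where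
  "visible P p q \<equiv> (p, q) \<in> parcs (visibility_graph P)"

lemma symp_visible: "symp (visible P)"
  by (auto simp: symp_def visibility_graph_def open_segment_commute)

lemma irreflp_visible: "irreflp (visible P)"
  by (auto simp: irreflp_def visibility_graph_def)

definition collinear_triples :: "(real^2) set \<Rightarrow> (real^2) set set" where
  "collinear_triples P = {X. X \<subseteq> P \<and> card X = 3 \<and> collinear X}"

lemma finite_collinear_triples: "finite P \<Longrightarrow> finite (collinear_triples P)"
  by (rule finite_subset[of _ "Pow P"]) (auto simp: collinear_triples_def)

text \<open>Two common points put \<open>X \<union> Y\<close> on one line, and distinct triples have
  at least four points in their union.\<close>

lemma card_Int_collinear_triples_le_1:
  assumes no4: "\<not> four_collinear P"
    and X: "X \<in> collinear_triples P" and Y: "Y \<in> collinear_triples P" and "X \<noteq> Y"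
  shows "card (X \<inter> Y) \<le> 1"
proof (rule ccontr)
  assume "\<not> ?thesis"
  then have "2 \<le> card (X \<inter> Y)" by simp
  then obtain Z where "Z \<subseteq> X \<inter> Y" "card Z = 2"
    by (meson obtain_subset_with_card_n)
  then obtain a b where ab: "a \<noteq> b" "a \<in> X \<inter> Y" "b \<in> X \<inter> Y"
    by (auto simp: card_2_iff)
  have fin: "finite X" "finite Y"
    using X Y by (auto simp: collinear_triples_def intro: card_ge_0_finite)
  have "\<forall>z\<in>X \<union> Y. collinear {a, b, z}"
    using X Y ab by (auto simp: collinear_triples_def intro: collinear_subset)
  then have "collinear (insert a (insert b (X \<union> Y)))"
    using collinear_triples[OF ab(1)] by blast
  moreover have "insert a (insert b (X \<union> Y)) = X \<union> Y" using ab by auto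
  ultimately have col: "collinear (X \<union> Y)" by simp
  have "X \<subset> X \<union> Y"
    using card_subset_eq[of X Y] fin X Y \<open>X \<noteq> Y\<close> by (auto simp: collinear_triples_def)
  then have "4 \<le> card (X \<union> Y)"
    using psubset_card_mono[of "X \<union> Y" X] fin X by (auto simp: collinear_triples_def)
  then obtain Z where "Z \<subseteq> X \<union> Y" "card Z = 4"
    by (meson obtain_subset_with_card_n)
  moreover have "X \<union> Y \<subseteq> P" using X Y by (auto simp: collinear_triples_def)
  ultimately show False
    using no4 collinear_subset[OF col] unfolding four_collinear_def by (meson order_trans)
qed

text \<open>Only finitely many directions are parallel to a line through two points of
  \<open>P\<close>; any other direction of projection separates the points.\<close>

lemma exists_linear_inj_on:
  fixes P :: "(real^2) set"
  assumes "finite P"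
  obtains f :: "real^2 \<Rightarrow> real" where "linear f" "inj_on f P"
proof -
  \<comment> \<open>Pairs with equal second coordinates contribute 0, the value of division by zero,
    which merely excludes \<open>s = 0\<close>.\<close>
  define bad where "bad = (\<lambda>(p, q). (q$1 - p$1) / (p$2 - q$2)) ` (P \<times> P)"
  have "finite bad" unfolding bad_def using assms by simp
  then obtain s where s: "s \<notin> bad"
    using ex_new_if_finite infinite_UNIV_char_0 by blast
  define f where "f p = p$1 + s * p$2" for p :: "real^2"
  show thesis
  proof
    show "linear f"
      by (rule linearI) (auto simp: f_def algebra_simps)
    show "inj_on f P"
    proof (rule inj_onI)
      fix p q assume pq: "p \<in> P" "q \<in> P" "f p = f q"
      have "p$2 = q$2"
      proof (rule ccontr)
        assume "p$2 \<noteq> q$2"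
        then have "s = (q$1 - p$1) / (p$2 - q$2)"
          using pq(3) by (simp add: f_def field_simps)
        then have "s \<in> bad" unfolding bad_def using pq(1,2) by force
        with s show False ..
      qed
      then show "p = q" using pq(3) by (simp add: f_def vec_eq_iff forall_2)
    qed
  qed
qed

lemma linear_strictly_between:
  fixes f :: "'a::real_vector \<Rightarrow> real"
  assumes "linear f" "b \<in> open_segment a c" "f a < f c"
  shows "f a < f b" "f b < f c"
proof -
  obtain u where u: "0 < u" "u < 1" "b = (1 - u) *\<^sub>R a + u *\<^sub>R c"
    using assms(2) by (auto simp: in_segment)
  have b: "f b = f a + u * (f c - f a)"
    unfolding u(3) linear_add[OF assms(1)] linear_scale[OF assms(1)] by (simp add: algebra_simps)
  show "f a < f b" using b u assms(3) by simp
  have "u * (f c - f a) < f c - f a" using u assms(3) by simp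
  then show "f b < f c" using b by simp
qed

text \<open>
  Every point of \<open>P\<close> between two points of a slab lies in the slab again, so each pair of invisible
  points is charged to a collinear triple within the slab whose extreme points they are.
\<close>

lemma card_visible_pairs_in_slab:
  fixes f :: "real^2 \<Rightarrow> real"
  assumes P: "finite P" and f: "linear f" "inj_on f P"
    and Q: "Q = {p\<in>P. a \<le> f p \<and> f p < b}"
  shows "(card Q)\<^sup>2 \<le> card {(p, q) \<in> Q \<times> Q. visible P p q} + card Q
    + 2 * card {X \<in> collinear_triples P. X \<subseteq> Q}"
proof -
  have finQ: "finite Q" and QP: "Q \<subseteq> P" using P Q by auto
  define N where "N = {(p, q) \<in> Q \<times> Q. f p < f q \<and> \<not> visible P p q}"
  have finN: "finite N"
    unfolding N_def by (rule finite_subset[of _ "Q \<times> Q"]) (use finQ in auto)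
  have "\<exists>z. z \<in> P \<and> z \<in> open_segment (fst e) (snd e)" if "e \<in> N" for e
    using that QP by (auto simp: N_def visibility_graph_def)
  then obtain z where z: "\<And>e. e \<in> N \<Longrightarrow> z e \<in> P \<and> z e \<in> open_segment (fst e) (snd e)"
    by metis
  define T where "T e = {fst e, z e, snd e}" for e
  have order: "f (fst e) < f (z e)" "f (z e) < f (snd e)" if "e \<in> N" for e
    using linear_strictly_between[OF f(1), of "z e" "fst e" "snd e"] z[OF that] that
    by (auto simp: N_def)
  have "T e \<in> collinear_triples P \<and> T e \<subseteq> Q" if e: "e \<in> N" for e
  proof -
    have "collinear (T e)"
      using z[OF e] unfolding T_def
      by (intro collinear_subset[OF collinear_closed_segment[of "fst e" "snd e"]])
        (auto simp: open_segment_def)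
    moreover have "card (T e) = 3" using order[OF e] unfolding T_def by (auto simp: card_insert_if)
    moreover have "T e \<subseteq> Q" using order[OF e] z[OF e] e unfolding T_def N_def Q by auto
    ultimately show ?thesis using QP by (auto simp: collinear_triples_def)
  qed
  moreover have "inj_on T N"
  proof (rule inj_onI)
    fix e e' assume e: "e \<in> N" "e' \<in> N" "T e = T e'"
    \<comment> \<open>The triple determines its pair as the points where \<open>f\<close> is least
      and greatest.\<close>
    have "Min (f ` T x) = f (fst x)" "Max (f ` T x) = f (snd x)" if "x \<in> N" for x
      using order[OF that] by (auto simp: T_def)
    with e have "f (fst e) = f (fst e')" "f (snd e) = f (snd e')" by metis+
    moreover have "fst x \<in> P" "snd x \<in> P" if "x \<in> N" for x
      using that QP by (auto simp: N_def)
    ultimately show "e = e'"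
      using e f(2) by (metis inj_onD prod.expand)
  qed
  ultimately have cardN: "card N \<le> card {X \<in> collinear_triples P. X \<subseteq> Q}"
    using finite_collinear_triples[OF P] by (intro card_inj_on_le[of T]) auto
  define E where "E = {(p, q) \<in> Q \<times> Q. visible P p q}"
  \<comment> \<open>The diagonal accounts for the summand \<open>card Q\<close>, the two
    orientations of invisible pairs for the factor 2.\<close>
  have "Q \<times> Q \<subseteq> E \<union> (\<lambda>p. (p, p)) ` Q \<union> N \<union> prod.swap ` N"
  proof (rule subsetI)
    fix e assume e: "e \<in> Q \<times> Q"
    then obtain p q where pq: "e = (p, q)" "p \<in> Q" "q \<in> Q" by auto
    then consider "visible P p q" | "p = q" | "f p < f q" "\<not> visible P p q"
      | "f q < f p" "\<not> visible P q p"
      using inj_onD[OF f(2), of p q] QP sympD[OF symp_visible] by fastforce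
    then show "e \<in> E \<union> (\<lambda>p. (p, p)) ` Q \<union> N \<union> prod.swap ` N"
    proof cases
      case 4
      then have "(q, p) \<in> N" using pq by (simp add: N_def)
      then have "prod.swap (q, p) \<in> prod.swap ` N" by (rule imageI)
      then show ?thesis using pq by simp
    qed (use pq in \<open>auto simp: E_def N_def\<close>)
  qed
  moreover have "finite E"
    unfolding E_def by (rule finite_subset[of _ "Q \<times> Q"]) (use finQ in auto)
  ultimately have "card (Q \<times> Q) \<le> card (E \<union> (\<lambda>p. (p, p)) ` Q \<union> N \<union> prod.swap ` N)"
    using finN finQ by (intro card_mono) auto
  also have "\<dots> \<le> card E + card Q + card N + card N"
    using finN finQ by (intro order_trans[OF card_Un_le] add_mono card_image_le order_refl) auto
  finally show ?thesis
    using cardN unfolding E_def power2_eq_square card_cartesian_product by linarith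
qed

lemma exists_dense_visible_subset:
  assumes P: "finite P" and no4: "\<not> four_collinear P" and m: "3 * m \<le> card P"
  obtains Q where "Q \<subseteq> P" "m \<le> card Q"
    "10 * (card Q)\<^sup>2 \<le> 13 * card {(p, q) \<in> Q \<times> Q. visible P p q} + 13 * card Q"
proof -
  obtain f :: "real^2 \<Rightarrow> real" where f: "linear f" "inj_on f P"
    using exists_linear_inj_on[OF P] .
  define slab where "slab a b = {p\<in>P. a \<le> f p \<and> f p < b}" for a b
  obtain r0 r1 r2 r3 where r: "r0 \<le> r1" "r1 \<le> r2" "r2 \<le> r3"
    and card_slab: "card (slab r0 r1) = m" "card (slab r1 r2) = m" "card (slab r2 r3) = m"
    unfolding slab_def using three_consecutive_slabs[OF P f(2) m] .
  have fin: "finite (slab a b)" for a b unfolding slab_def using P by simp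
  \<comment> \<open>The unions are slabs too, so the sparse set \<open>Q\<close> is a slab in every
    case.\<close>
  have un: "slab r0 r1 \<union> slab r1 r2 = slab r0 r2" "slab r1 r2 \<union> slab r2 r3 = slab r1 r3"
    using r by (auto simp: slab_def)
  have "\<exists>Q\<in>{slab r0 r1, slab r1 r2, slab r2 r3, slab r0 r1 \<union> slab r1 r2, slab r1 r2 \<union> slab r2 r3}.
      26 * card {X \<in> collinear_triples P. X \<subseteq> Q} \<le> 3 * (card Q)\<^sup>2"
  proof (rule sparse_part_of_linear_triple_system[OF finite_collinear_triples[OF P] fin fin fin])
    show "card X = 3" if "X \<in> collinear_triples P" for X
      using that by (simp add: collinear_triples_def)
    show "slab r0 r1 \<inter> slab r1 r2 = {}" "slab r1 r2 \<inter> slab r2 r3 = {}" "slab r0 r1 \<inter> slab r2 r3 = {}"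
      using r by (auto simp: slab_def)
  qed (use card_Int_collinear_triples_le_1[OF no4] card_slab in auto)
  then obtain Q where Q: "Q \<in> {slab r0 r1, slab r1 r2, slab r2 r3, slab r0 r2, slab r1 r3}"
    and sparse: "26 * card {X \<in> collinear_triples P. X \<subseteq> Q} \<le> 3 * (card Q)\<^sup>2"
    unfolding un by blast
  from Q obtain a b where ab: "Q = slab a b" by blast
  show thesis
  proof
    show "Q \<subseteq> P" unfolding ab slab_def by auto
    have "slab r0 r1 \<subseteq> Q \<or> slab r1 r2 \<subseteq> Q \<or> slab r2 r3 \<subseteq> Q"
      using Q un by auto
    then show "m \<le> card Q"
      using card_slab ab by (metis card_mono fin)
    show "10 * (card Q)\<^sup>2 \<le> 13 * card {(p, q) \<in> Q \<times> Q. visible P p q} + 13 * card Q"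
      using card_visible_pairs_in_slab[OF P f ab[unfolded slab_def]] sparse by linarith
  qed
qed

text \<open>The densities descend as 10/13 > 19/25 > 151/200 > 3/4: on \<open>Q\<close> up to a
  linear term, for the passage to \<open>S\<close>, for the minimum degree in \<open>S\<close>, and
  the threshold for five parts.\<close>

lemma exists_mutually_visible_sets:
  "\<exists>N. \<forall>P. finite P \<and> N \<le> card P \<and> \<not> four_collinear P \<longrightarrow>
    (\<exists>F. (\<forall>i<5. F i \<subseteq> P \<and> card (F i) = t) \<and> mutually_joined (visible P) 5 F)"
proof -
  have "\<exists>n0. \<forall>(V :: (real^2) set) E. finite V \<and> n0 \<le> card V \<and> symp E \<and>
      (\<forall>v\<in>V. 151 / 200 * card V \<le> card {u\<in>V. E v u}) \<longrightarrow>
      (\<exists>F. (\<forall>i<5. F i \<subseteq> V \<and> card (F i) = t) \<and> mutually_joined E 5 F)"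
    by (rule erdos_stone_min_degree) simp_all
  then obtain n0 where n0: "\<forall>(V :: (real^2) set) E. finite V \<and> n0 \<le> card V \<and> symp E \<and>
      (\<forall>v\<in>V. 151 / 200 * card V \<le> card {u\<in>V. E v u}) \<longrightarrow>
      (\<exists>F. (\<forall>i<5. F i \<subseteq> V \<and> card (F i) = t) \<and> mutually_joined E 5 F)"
    by (rule exE)
  \<comment> \<open>The 76 absorbs the \<open>1 / 2\<close> in the degree bound when 19/25 drops to
    151/200. The factor 15 is the loss from \<open>Q\<close> to \<open>S\<close>: 10/13 - 19/25 =
    3/325 exceeds 1/225, with room for the linear term once
    \<open>card Q \<ge> 1140\<close>.\<close>
  define m where "m = 15 * (n0 + 76)"
  show ?thesis
  proof (intro exI[of _ "3 * m"] allI impI, elim conjE)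
    fix P :: "(real^2) set"
    assume P: "finite P" "3 * m \<le> card P" "\<not> four_collinear P"
    obtain Q where Q: "Q \<subseteq> P" "m \<le> card Q"
      "10 * (card Q)\<^sup>2 \<le> 13 * card {(p, q) \<in> Q \<times> Q. visible P p q} + 13 * card Q"
      using exists_dense_visible_subset[OF P(1,3,2)] .
    have "finite Q" using Q(1) P(1) finite_subset by blast
    obtain S where S: "S \<subseteq> Q"
      "card {(p, q) \<in> Q \<times> Q. visible P p q} - 19 / 25 * (card Q)\<^sup>2 \<le> (card S)\<^sup>2"
      "\<And>v. v \<in> S \<Longrightarrow> 19 / 25 * (card S - 1 / 2) \<le> card {u\<in>S. visible P v u}"
      by (rule dense_graph_has_subset_of_large_min_degree
          [OF \<open>finite Q\<close> symp_visible[of P] irreflp_visible[of P], of "19 / 25"]) auto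
    have "1140 * real (card Q) \<le> (real (card Q))\<^sup>2"
      unfolding power2_eq_square using Q(2) m_def by (intro mult_right_mono) auto
    moreover have "10 * (real (card Q))\<^sup>2 \<le> 13 * card {(p, q) \<in> Q \<times> Q. visible P p q} + 13 * card Q"
      using Q(3) by (metis (mono_tags, lifting) of_nat_add of_nat_le_iff of_nat_mult of_nat_numeral of_nat_power)
    ultimately have "(real (card Q))\<^sup>2 \<le> (15 * real (card S))\<^sup>2"
      using S(2) by (simp add: power_mult_distrib)
    then have "real (card Q) \<le> 15 * real (card S)"
      by (rule power2_le_imp_le) simp
    then have "real (card Q) \<le> real (15 * card S)" by simp
    then have "card Q \<le> 15 * card S" by (rule of_nat_le_iff[THEN iffD1])
    then have cardS: "n0 + 76 \<le> card S"
      using Q(2) by (simp add: m_def)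
    have "151 / 200 * card S \<le> card {u\<in>S. visible P v u}" if "v \<in> S" for v
      using S(3)[OF that] cardS by (simp add: field_simps)
    then obtain F where "\<forall>i<5. F i \<subseteq> S \<and> card (F i) = t" "mutually_joined (visible P) 5 F"
      using n0[rule_format, of S "visible P"] cardS symp_visible finite_subset[OF S(1) \<open>finite Q\<close>]
      by auto
    then show "\<exists>F. (\<forall>i<5. F i \<subseteq> P \<and> card (F i) = t) \<and> mutually_joined (visible P) 5 F"
      using S(1) Q(1) by (meson order_trans)
  qed
qed

section \<open>Embedding a coloured graph\<close>

lemma has_copy_if_injective_homomorphism:
  assumes H: "pair_wf_digraph H" and G: "pair_wf_digraph G"
    and \<phi>: "inj_on \<phi> (pverts H)" "\<phi> ` pverts H \<subseteq> pverts G"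
      "\<And>u v. (u, v) \<in> parcs H \<Longrightarrow> (\<phi> u, \<phi> v) \<in> parcs G"
  shows "has_copy H G"
proof -
  define K where "K = \<lparr>pverts = \<phi> ` pverts H, parcs = map_prod \<phi> \<phi> ` parcs H\<rparr>"
  define h where "h = \<lparr>iso_verts = \<phi>, iso_arcs = map_prod \<phi> \<phi>, iso_head = snd, iso_tail = fst\<rparr>"
  interpret H: pair_wf_digraph H by fact
  have arcs: "parcs H \<subseteq> pverts H \<times> pverts H"
    using H.in_arcsD1 H.in_arcsD2 by auto
  have "inj_on (map_prod \<phi> \<phi>) (parcs H)"
    using map_prod_inj_on[OF \<phi>(1) \<phi>(1)] arcs by (rule inj_on_subset)
  then have "pre_digraph.digraph_isomorphism (with_proj H) h"
    unfolding pre_digraph.digraph_isomorphism_def h_def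
    using \<phi>(1) H.wf_digraph_axioms by simp
  moreover have "with_proj K = app_iso h (with_proj H)"
    by (simp add: K_def h_def app_iso_def with_proj_def)
  moreover have "pair_wf_digraph K"
    using arcs by unfold_locales (auto simp: K_def)
  then have "subgraph (with_proj K) (with_proj G)"
    using \<phi>(2,3) G by (auto simp: subgraph_def wf_digraph_wp_iff compatible_def K_def)
  ultimately show ?thesis
    unfolding has_copy_def digraph_iso_def by blast
qed

text \<open>Each colour class is sent injectively into its own part. Vertices of different colours
  get adjacent images, which are distinct because \<open>G\<close> has no loops.\<close>

lemma has_copy_if_mutually_joined:
  assumes H: "pair_graph H" "proper_coloring H k c" and G: "pair_graph G"
    and F: "\<And>i. i < k \<Longrightarrow> F i \<subseteq> pverts G \<and> card (F i) = card (pverts H)"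
    and joined: "mutually_joined (\<lambda>x y. (x, y) \<in> parcs G) k F"
  shows "has_copy H G"
proof -
  interpret H: pair_graph H by fact
  interpret G: pair_graph G by fact
  have "\<exists>g. g ` pverts H \<subseteq> F i \<and> inj_on g (pverts H)" if "i < k" for i
  proof (rule card_le_inj)
    show "finite (F i)"
      using F[OF that] G.pair_finite_verts finite_subset by blast
  qed (use F[OF that] in auto)
  then obtain g where g: "\<And>i. i < k \<Longrightarrow> g i ` pverts H \<subseteq> F i \<and> inj_on (g i) (pverts H)"
    by metis
  define \<phi> where "\<phi> v = g (c v) v" for v
  have c: "c v < k" if "v \<in> pverts H" for v
    using H(2) that by (simp add: proper_coloring_def)
  have \<phi>: "\<phi> v \<in> F (c v)" if "v \<in> pverts H" for v
    using g[OF c[OF that]] that by (auto simp: \<phi>_def)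
  have adj: "(\<phi> u, \<phi> v) \<in> parcs G" if "u \<in> pverts H" "v \<in> pverts H" "c u \<noteq> c v" for u v
    using joined c \<phi> that unfolding mutually_joined_def by blast
  show ?thesis
  proof (rule has_copy_if_injective_homomorphism[OF H.pair_wf_digraph_axioms G.pair_wf_digraph_axioms])
    show "inj_on \<phi> (pverts H)"
    proof (rule inj_onI)
      fix u v assume uv: "u \<in> pverts H" "v \<in> pverts H" "\<phi> u = \<phi> v"
      have "c u = c v" using adj[OF uv(1,2)] uv(3) G.pair_no_loops by fastforce
      then show "u = v"
        using uv g[OF c[OF uv(1)]] by (auto simp: \<phi>_def dest: inj_onD)
    qed
    show "\<phi> ` pverts H \<subseteq> pverts G" using \<phi> c F by blast
    show "(\<phi> u, \<phi> v) \<in> parcs G" if "(u, v) \<in> parcs H" for u v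
      using that H(2) H.in_arcsD1 H.in_arcsD2 by (intro adj) (auto simp: proper_coloring_def)
  qed
qed

theorem theorem1p1:
  fixes H :: "'a pair_pre_digraph"
  assumes "pair_graph H"
    and "chromatic_number H \<le> 5"
  shows "\<exists>N_H :: nat. \<forall>P :: (real^2) set. finite P \<and> card P \<ge> N_H \<longrightarrow>
           four_collinear P \<or> has_copy H (visibility_graph P)"
proof -
  obtain c where "proper_coloring H (chromatic_number H) c"
    using chromatic_number_attained[OF assms(1)] by blast
  with assms(2) have c: "proper_coloring H 5 c"
    unfolding proper_coloring_def by fastforce
  obtain N where N: "\<forall>P. finite P \<and> N \<le> card P \<and> \<not> four_collinear P \<longrightarrow>
      (\<exists>F. (\<forall>i<5. F i \<subseteq> P \<and> card (F i) = card (pverts H)) \<and> mutually_joined (visible P) 5 F)"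
    using exists_mutually_visible_sets[of "card (pverts H)"] by blast
  have "has_copy H (visibility_graph P)" if P: "finite P" "N \<le> card P" "\<not> four_collinear P" for P
  proof -
    obtain F where "\<forall>i<5. F i \<subseteq> P \<and> card (F i) = card (pverts H)" "mutually_joined (visible P) 5 F"
      using N P by blast
    then show ?thesis
      by (intro has_copy_if_mutually_joined[OF assms(1) c pair_graph_visibility_graph[OF P(1)]])
        (auto simp: visibility_graph_def)
  qed
  then show ?thesis by blast
qed

end
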